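(* Let $n\ge 3$ and let $(C_n,L)$ be an edge-labeled $n$-cycle with positive integer edge labels $\ell_1,\dots,\ell_n$. If $(0,g_2,\dots,g_n)$ is a generalized spline on $(C_n,L)$, then $g_2$ is a multiple of $\operatorname{lcm}(\ell_1,\gcd(\ell_2,\dots,\ell_n))$. Moreover, there exists a generalized spline $(0,g_2,\dots,g_n)$ on $(C_n,L)$ with $g_2=\operatorname{lcm}(\ell_1,\gcd(\ell_2,\dots,\ell_n))$, so this is the smallest positive value of the leading entry of a flow-up class $\mathcal{G}_1$.
   Context: An edge-labeled $n$-cycle $(C_n,L)$: vertices $v_1,\dots,v_n$; edge $e_i$ joins $v_i$ and $v_{i+1}$ for $1\le i\le n-1$, and $e_n$ joins $v_n$ and $v_1$; edge $e_i$ carries label $\ell_i$. A generalized spline on $(C_n,L)$ is a tuple $(g_1,\dots,g_n)\in\mathbb{Z}^n$ with $g_i\equiv g_{i+1}\pmod{\ell_i}$ for $1\le i\le n-1$ and $g_n\equiv g_1\pmod{\ell_n}$. A flow-up class $\mathcal{G}_1$ is a spline $(0,g_2,\dots,g_n)$ with $g_2\neq0$. *)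

theory Defs
  imports "HOL-Number_Theory.Cong"
begin

text \<open>
  Tuples and edge labels are functions on \<^typ>\<open>nat\<close> of which only the values at the indices
  \<open>1, \<dots>, n\<close> are used.  The label \<open>l i\<close> belongs to the edge joining \<open>v\<^sub>i\<close> and
  \<open>v\<^sub>i\<^sub>+\<^sub>1\<close> for \<open>i < n\<close>, and \<open>l n\<close> to the edge joining \<open>v\<^sub>n\<close> and \<open>v\<^sub>1\<close>.
\<close>

definition cycle_spline :: "nat \<Rightarrow> (nat \<Rightarrow> int) \<Rightarrow> (nat \<Rightarrow> int) \<Rightarrow> bool" where
  "cycle_spline n l g \<longleftrightarrow>
     (\<forall>i\<in>{1..<n}. [g i = g (i + 1)] (mod l i)) \<and> [g n = g 1] (mod l n)"

definition flow_up_1 :: "nat \<Rightarrow> (nat \<Rightarrow> int) \<Rightarrow> (nat \<Rightarrow> int) \<Rightarrow> bool" where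
  "flow_up_1 n l g \<longleftrightarrow> cycle_spline n l g \<and> g 1 = 0 \<and> g 2 \<noteq> 0"

end

theory Submission
  imports Defs
begin

text \<open>
  Let \<open>d\<close> be the gcd of \<open>l 2, \<dots>, l n\<close>. Modulo \<open>d\<close> all congruences along the path
  \<open>v\<^sub>2, \<dots>, v\<^sub>n, v\<^sub>1\<close> hold at once, so \<open>g 1 = 0\<close> forces \<open>d dvd g 2\<close>; the first edge gives
  \<open>l 1 dvd g 2\<close>. Conversely, by Bezout every multiple of \<open>d\<close> is a sum of multiples of
  \<open>l 2, \<dots>, l n\<close>, and subtracting the summands one edge at a time leads from that multiple down
  to \<open>0\<close> along the same path.
\<close>

text \<open>Divisibility by the gcd travels backwards from \<open>m\<close> to \<open>k\<close>, one
  edge at a time, since the gcd divides every label on the way. For a spline with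
  \<open>g 1 = 0\<close>, the closing edge supplies \<open>last\<close>.\<close>

lemma Gcd_dvd_path_start:
  fixes l g :: "nat \<Rightarrow> int"
  assumes "k \<le> m" and path: "\<forall>i\<in>{k..<m}. [g i = g (i + 1)] (mod l i)"
    and last: "[g m = 0] (mod l m)"
  shows "(GCD i\<in>{k..m}. l i) dvd g k"
proof -
  define d where "d = (GCD i\<in>{k..m}. l i)"
  have d: "d dvd l i" if "i \<in> {k..m}" for i
    unfolding d_def using that by (intro Gcd_dvd) auto
  have "d dvd g k"
    using \<open>k \<le> m\<close>
  proof (rule inc_induct[where P = "\<lambda>i. d dvd g i"])
    show "d dvd g m"
      using last d[of m] \<open>k \<le> m\<close> by (auto simp: cong_0_iff intro: dvd_trans)
  next
    fix i assume i: "k \<le> i" "i < m" and IH: "d dvd g (Suc i)"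
    have "[g i = g (Suc i)] (mod d)"
      using path i d[of i] by (auto intro: cong_dvd_modulus)
    then show "d dvd g i"
      using IH by (simp add: dvd_eq_mod_eq_0 cong_def)
  qed
  then show ?thesis by (simp add: d_def)
qed

text \<open>Induction on \<open>m\<close> with \<open>c\<close> arbitrary: Bezout splits
  \<open>c\<close> into a multiple of the new label and a multiple of the old gcd, and only the
  latter goes to the induction hypothesis.\<close>

lemma path_from_Gcd_multiple:
  fixes l :: "nat \<Rightarrow> int"
  assumes "k \<le> m" and "(GCD i\<in>{k..m}. l i) dvd c"
  shows "\<exists>g. g k = c \<and> (\<forall>i\<in>{k..<m}. [g i = g (i + 1)] (mod l i)) \<and> [g m = 0] (mod l m)"
  using assms
proof (induction m arbitrary: c rule: dec_induct)
  case base
  then show ?case by (intro exI[of _ "\<lambda>_. c"]) (simp add: cong_0_iff)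
next
  case (step m)
  let ?d = "GCD i\<in>{k..m}. l i" and ?e = "l (Suc m)"
  have "{k..Suc m} = insert (Suc m) {k..m}" using step.hyps by auto
  then have "gcd ?e ?d dvd c" using step.prems by simp
  then obtain t where t: "c = gcd ?e ?d * t" ..
  obtain u v where "u * ?e + v * ?d = gcd ?e ?d" using bezout_int by blast
  then have c: "c = t * u * ?e + t * v * ?d"
    using t by (metis distrib_left mult.assoc mult.commute)
  obtain g where g: "g k = t * v * ?d" "\<forall>i\<in>{k..<m}. [g i = g (i + 1)] (mod l i)"
      "[g m = 0] (mod l m)"
    using step.IH[of "t * v * ?d"] by auto
  \<comment> \<open>A constant shift preserves congruences. The default 0 at \<open>Suc m\<close>
    makes edge \<open>m\<close> the old end condition on \<open>g m\<close> and leaves a multiple of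
    \<open>?e\<close> as the new end value.\<close>
  define h where "h i = (if i \<le> m then g i else 0) + t * u * ?e" for i
  have "[h i = h (i + 1)] (mod l i)" if "i \<in> {k..<Suc m}" for i
  proof (cases "i = m")
    case True
    then show ?thesis using cong_add[OF g(3) cong_refl] by (simp add: h_def)
  next
    case False
    then have "[g i = g (i + 1)] (mod l i)" using g(2) that by auto
    then show ?thesis using False that cong_add[OF _ cong_refl] by (simp add: h_def)
  qed
  moreover have "h k = c" using g(1) c step.hyps by (simp add: h_def)
  moreover have "[h (Suc m) = 0] (mod ?e)" by (simp add: h_def cong_0_iff)
  ultimately show ?case by blast
qed

theorem theorem4p4:
  fixes n :: nat and l :: "nat \<Rightarrow> int"
  assumes "n \<ge> 3"
    and "\<forall>i\<in>{1..n}. l i > 0"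
  shows "(\<forall>g. cycle_spline n l g \<and> g 1 = 0 \<longrightarrow> lcm (l 1) (GCD i\<in>{2..n}. l i) dvd g 2) \<and>
    (\<exists>g. cycle_spline n l g \<and> g 1 = 0 \<and> g 2 = lcm (l 1) (GCD i\<in>{2..n}. l i)) \<and>
    lcm (l 1) (GCD i\<in>{2..n}. l i) \<in> {g 2 | g. flow_up_1 n l g \<and> g 2 > 0} \<and>
    (\<forall>x\<in>{g 2 | g. flow_up_1 n l g \<and> g 2 > 0}. lcm (l 1) (GCD i\<in>{2..n}. l i) \<le> x)"
proof -
  let ?d = "GCD i\<in>{2..n}. l i"
  let ?L = "lcm (l 1) ?d"
  have dvd: "?L dvd g 2" if "cycle_spline n l g" "g 1 = 0" for g
  proof (rule lcm_least)
    have "[g 1 = g (1 + 1)] (mod l 1)"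
      using that(1) \<open>n \<ge> 3\<close> by (simp add: cycle_spline_def)
    then show "l 1 dvd g 2"
      using that(2) by (metis cong_0_iff cong_sym one_add_one)
    show "?d dvd g 2"
      using that \<open>n \<ge> 3\<close> by (intro Gcd_dvd_path_start) (auto simp: cycle_spline_def)
  qed
  obtain g where g: "g 2 = ?L" "\<forall>i\<in>{2..<n}. [g i = g (i + 1)] (mod l i)" "[g n = 0] (mod l n)"
    using path_from_Gcd_multiple[of 2 n l ?L] \<open>n \<ge> 3\<close> by auto
  \<comment> \<open>The path starts at index 2, so the value at 1 is free; setting it to 0 turns the
    end condition at \<open>n\<close> into the closing edge.\<close>
  define h where "h = g(1 := 0)"
  have "[h i = h (i + 1)] (mod l i)" if "i \<in> {1..<n}" for i
  proof (cases "i = 1")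
    case True
    have "[0 = ?L] (mod l 1)" by (simp add: cong_0_iff cong_sym_eq[of 0])
    then show ?thesis using True g(1) by (simp add: h_def numeral_2_eq_2)
  next
    case False
    then show ?thesis using g(2) that by (auto simp: h_def)
  qed
  then have h: "cycle_spline n l h" "h 1 = 0" "h 2 = ?L"
    using g \<open>n \<ge> 3\<close> by (auto simp: cycle_spline_def h_def)
  \<comment> \<open>Positivity of \<open>?L\<close> is what makes \<open>h\<close> a flow-up
    class.\<close>
  have "l 1 > 0" "l 2 > 0" using assms by simp_all
  moreover have "?d \<noteq> 0" using \<open>l 2 > 0\<close> \<open>n \<ge> 3\<close>
    by (auto simp: Gcd_0_iff image_subset_iff intro!: bexI[of _ 2])
  ultimately have pos: "?L > 0" by (simp add: lcm_pos_int)
  have "?L \<le> x" if "x \<in> {g 2 | g. flow_up_1 n l g \<and> g 2 > 0}" for x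
    using that dvd by (auto simp: flow_up_1_def intro: zdvd_imp_le)
  moreover have "?L \<in> {g 2 | g. flow_up_1 n l g \<and> g 2 > 0}"
    unfolding mem_Collect_eq flow_up_1_def using h pos by (metis less_irrefl)
  ultimately show ?thesis using dvd h by blast
qed

end
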